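(* Let $(\Omega,\mu)$ be a $\sigma$-finite measure space. Let $\hat A(x)$, $x\in\Omega$, be an $n\times n$ Hermitian random matrix on $\Omega$ with eigenvalue functions $\{\hat\lambda_j(x)\}_{j=1}^n$ arranged in increasing order. Let $A(x)$ be a principal random submatrix of $\hat A(x)$ of order $n-1$ with eigenvalue functions $\{\lambda_j(x)\}_{j=1}^{n-1}$ arranged in increasing order. Then $$\hat\lambda_1(x)\le\lambda_1(x)\le\hat\lambda_2(x)\le\lambda_2(x)\le\cdots\le\lambda_{n-2}(x)\le\hat\lambda_{n-1}(x)\le\lambda_{n-1}(x)\le\hat\lambda_n(x)$$ for all $x\in\Omega$. In general, if $A(x)$ is an $r\times r$ principal random submatrix of $\hat A(x)$ obtained by deleting $n-r$ rows and the corresponding columns from $\hat A(x)$, then $$\lambda_k(\hat A(x))\le\lambda_k(A(x))\le\lambda_{k+n-r}(\hat A(x)),\qquad\forall x\in\Omega,\ 1\le k\le r.$$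
   Context: An $n\times n$ random matrix on $\Omega$ is a matrix whose entries are (complex-valued) measurable functions on $\Omega$; it is Hermitian if $A(x)$ is Hermitian for every $x\in\Omega$. For a Hermitian random matrix $A$ of size $n$, $\lambda_1(A(x))\le\cdots\le\lambda_n(A(x))$ denote the eigenvalues of $A(x)$, counted with multiplicity, in increasing order; they are measurable functions on $\Omega$. In a principal random submatrix the same rows and columns are deleted for all $x$. *)

theory Defs
  imports
    "HOL-Analysis.Measure_Space"
    "HOL-Analysis.Borel_Space"
    "HOL-Computational_Algebra.Fundamental_Theorem_Algebra"
    "Jordan_Normal_Form.Schur_Decomposition"
    "Jordan_Normal_Form.DL_Submatrix"
begin

unbundle no vec_syntax

text \<open>\<^const>\<open>mat_adjoint\<close> swaps the dimensions, so the equation forces the matrix to be square.\<close>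

definition hermitian_mat :: "complex mat \<Rightarrow> bool" where
  "hermitian_mat A \<longleftrightarrow> mat_adjoint A = A"

text \<open>
  \<^const>\<open>proots\<close> is the multiset of roots with multiplicity. Taking real parts loses nothing
  for Hermitian matrices, see \<open>hermitian_eigenvalue_list\<close> below.
\<close>

definition eigenvalue_list :: "complex mat \<Rightarrow> real list" where
  "eigenvalue_list A = sorted_list_of_multiset (image_mset Re (proots (char_poly A)))"

text \<open>Eigenvalues are numbered from 1, list positions from 0.\<close>

definition ordered_eigenvalue :: "nat \<Rightarrow> complex mat \<Rightarrow> real" where
  "ordered_eigenvalue k A = eigenvalue_list A ! (k - 1)"

definition random_matrix :: "'a measure \<Rightarrow> nat \<Rightarrow> ('a \<Rightarrow> complex mat) \<Rightarrow> bool" where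
  "random_matrix M n A \<longleftrightarrow>
     (\<forall>x\<in>space M. A x \<in> carrier_mat n n) \<and>
     (\<forall>i<n. \<forall>j<n. (\<lambda>x. A x $$ (i, j)) \<in> borel_measurable M)"

definition hermitian_random_matrix :: "'a measure \<Rightarrow> nat \<Rightarrow> ('a \<Rightarrow> complex mat) \<Rightarrow> bool" where
  "hermitian_random_matrix M n A \<longleftrightarrow>
     random_matrix M n A \<and> (\<forall>x\<in>space M. hermitian_mat (A x))"

text \<open>The set \<open>I\<close> of (0-based) retained row and column indices does not depend on \<open>x\<close>.\<close>

definition principal_random_submatrix ::
  "'a measure \<Rightarrow> nat \<Rightarrow> nat \<Rightarrow> ('a \<Rightarrow> complex mat) \<Rightarrow> ('a \<Rightarrow> complex mat) \<Rightarrow> bool" where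
  "principal_random_submatrix M n r A' A \<longleftrightarrow>
     (\<exists>I\<subseteq>{..<n}. card I = r \<and> (\<forall>x\<in>space M. A x = submatrix (A' x) I I))"

lemma hermitian_mat_iff:
  assumes A: "A \<in> carrier_mat n n"
  shows "hermitian_mat A \<longleftrightarrow> (\<forall>i<n. \<forall>j<n. A $$ (i, j) = cnj (A $$ (j, i)))"
proof -
  have adj: "mat_adjoint A \<in> carrier_mat n n"
    "\<And>i j. i < n \<Longrightarrow> j < n \<Longrightarrow> mat_adjoint A $$ (i, j) = cnj (A $$ (j, i))"
    using A by (auto simp: mat_adjoint_def mat_of_rows_def)
  have "mat_adjoint A = A \<longleftrightarrow> (\<forall>i<n. \<forall>j<n. mat_adjoint A $$ (i, j) = A $$ (i, j))"
    using A adj(1) by (intro iffI) (auto intro!: eq_matI)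
  also have "\<dots> \<longleftrightarrow> (\<forall>i<n. \<forall>j<n. A $$ (i, j) = cnj (A $$ (j, i)))"
    using adj(2) by metis
  finally show ?thesis unfolding hermitian_mat_def .
qed

lemma hermitian_eigenvalue_real:
  assumes A: "A \<in> carrier_mat n n" and H: "hermitian_mat A" and k: "eigenvalue A k"
  shows "k \<in> \<real>"
proof -
  obtain v where v: "v \<in> carrier_vec n" "v \<noteq> 0\<^sub>v n" and Av: "A *\<^sub>v v = k \<cdot>\<^sub>v v"
    using k A unfolding eigenvalue_def eigenvector_def by auto
  have h: "cnj (A $$ (i, j)) = A $$ (j, i)" if "i < n" "j < n" for i j
    using H that unfolding hermitian_mat_iff[OF A] by (metis complex_cnj_cnj)
  define S where "S = (\<Sum>i<n. \<Sum>j<n. cnj (v $ i) * (A $$ (i, j) * v $ j))"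
  define N where "N = (\<Sum>i<n. cnj (v $ i) * v $ i)"
  have row: "(\<Sum>j<n. A $$ (i, j) * v $ j) = k * v $ i" if "i < n" for i
  proof -
    have "(A *\<^sub>v v) $ i = (\<Sum>j<n. A $$ (i, j) * v $ j)"
      using A v that by (auto simp: scalar_prod_def row_def lessThan_atLeast0 intro!: sum.cong)
    thus ?thesis using Av v that by simp
  qed
  have S: "S = k * N"
    unfolding S_def N_def sum_distrib_left[symmetric]
    by (auto simp: row sum_distrib_left intro!: sum.cong)
  have "cnj S = (\<Sum>i<n. \<Sum>j<n. cnj (v $ j) * (A $$ (j, i) * v $ i))"
    unfolding S_def cnj_sum by (intro sum.cong refl) (simp add: h)
  also have "\<dots> = S" unfolding S_def by (rule sum.swap)
  finally have cS: "cnj S = S" .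
  have N: "N = of_real (\<Sum>i<n. (cmod (v $ i))\<^sup>2)"
    unfolding N_def of_real_sum
    by (intro sum.cong refl) (metis complex_norm_square mult.commute)
  have "N \<noteq> 0"
  proof
    assume "N = 0"
    hence "(\<Sum>i<n. (cmod (v $ i))\<^sup>2) = 0" unfolding N of_real_eq_0_iff .
    hence "\<forall>i<n. v $ i = 0" by (subst (asm) sum_nonneg_eq_0_iff) auto
    with v show False by (auto simp: vec_eq_iff)
  qed
  moreover have "cnj N = N" unfolding N by simp
  ultimately have "cnj k = k" using cS unfolding S by simp
  thus ?thesis by (simp add: Reals_cnj_iff)
qed

lemma hermitian_eigenvalue_list:
  assumes A: "A \<in> carrier_mat n n" and H: "hermitian_mat A"
  shows "sorted (eigenvalue_list A)" and "length (eigenvalue_list A) = n"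
    and "image_mset complex_of_real (mset (eigenvalue_list A)) = proots (char_poly A)"
proof -
  have dp: "degree (char_poly A) = n" and p0: "char_poly A \<noteq> 0"
    using degree_monic_char_poly[OF A] by auto
  show "sorted (eigenvalue_list A)" by (simp add: eigenvalue_list_def)
  have "size (mset (eigenvalue_list A)) = n"
    by (simp add: eigenvalue_list_def size_proots_complex dp del: size_mset)
  thus "length (eigenvalue_list A) = n" by simp
  have "complex_of_real (Re a) = a" if "a \<in># proots (char_poly A)" for a
    using that p0 hermitian_eigenvalue_real[OF A H] eigenvalue_root_char_poly[OF A] by simp
  hence "image_mset (\<lambda>a. complex_of_real (Re a)) (proots (char_poly A))
      = image_mset (\<lambda>a. a) (proots (char_poly A))"
    by (intro image_mset_cong) auto
  thus "image_mset complex_of_real (mset (eigenvalue_list A)) = proots (char_poly A)"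
    by (simp add: eigenvalue_list_def multiset.map_comp comp_def)
qed

end

theory Submission
  imports Defs
begin

text \<open>
  Pointwise in \<open>x\<close> this is Cauchy interlacing. A principal submatrix is \<open>E\<^sup>* A E\<close> for an isometry
  \<open>E\<close> of the smaller space into the larger one, so the two quadratic forms and norms agree on
  \<open>z\<close> and \<open>E z\<close>. Expand both in orthonormal eigenbases and choose a nonzero \<open>z\<close> on which \<open>r - 1\<close>
  coordinates vanish: the low ones of one matrix and the high ones of the other. Then one
  Rayleigh quotient is bounded below by one eigenvalue and the other, equal to it, is bounded
  above by the other eigenvalue.
\<close>

section \<open>Adjoints, matrix products and the Hermitian inner product in coordinates\<close>

lemma dim_mat_adjoint [simp]:
  "dim_row (mat_adjoint A) = dim_col A" "dim_col (mat_adjoint A) = dim_row A"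
  by (auto simp: mat_adjoint_def mat_of_rows_def)

lemma mat_adjoint_carrier [simp]:
  "A \<in> carrier_mat n m \<Longrightarrow> mat_adjoint A \<in> carrier_mat m n"
  by (auto simp: mat_adjoint_def mat_of_rows_def)

lemma mat_adjoint_index:
  assumes "A \<in> carrier_mat n m" "i < m" "j < n"
  shows "mat_adjoint A $$ (i, j) = cnj (A $$ (j, i))"
  using assms by (auto simp: mat_adjoint_def mat_of_rows_def)

lemma mat_adjoint_eqI:
  assumes "A \<in> carrier_mat n m" "B \<in> carrier_mat m n"
    and "\<And>i j. i < m \<Longrightarrow> j < n \<Longrightarrow> B $$ (i, j) = cnj (A $$ (j, i))"
  shows "mat_adjoint A = B"
  using assms mat_adjoint_carrier[OF assms(1)]
  by (intro eq_matI) (auto simp: mat_adjoint_index[OF assms(1)])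

lemma mat_adjoint_adjoint [simp]:
  fixes A :: "complex mat"
  shows "mat_adjoint (mat_adjoint A) = A"
proof -
  have A: "A \<in> carrier_mat (dim_row A) (dim_col A)" by simp
  show ?thesis
    by (rule mat_adjoint_eqI[OF mat_adjoint_carrier[OF A] A]) (simp add: mat_adjoint_index[OF A])
qed

lemma mult_mat_index_sum:
  assumes "A \<in> carrier_mat n m" "B \<in> carrier_mat m l" "i < n" "j < l"
  shows "(A * B) $$ (i, j) = (\<Sum>k<m. A $$ (i, k) * B $$ (k, j))"
  using assms by (auto simp: scalar_prod_def lessThan_atLeast0 intro!: sum.cong)

lemma mult_mat_vec_index_sum:
  assumes "A \<in> carrier_mat n m" "v \<in> carrier_vec m" "i < n"
  shows "(A *\<^sub>v v) $ i = (\<Sum>k<m. A $$ (i, k) * v $ k)"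
  using assms by (auto simp: scalar_prod_def lessThan_atLeast0 intro!: sum.cong)

lemma mult_mat3_vec:
  assumes A: "A \<in> carrier_mat n m" and B: "B \<in> carrier_mat m l" and C: "C \<in> carrier_mat l p"
    and v: "v \<in> carrier_vec p"
  shows "A * B * C *\<^sub>v v = A *\<^sub>v (B *\<^sub>v (C *\<^sub>v v))"
  using assoc_mult_mat_vec[OF mult_carrier_mat[OF A B] C v]
    assoc_mult_mat_vec[OF A B mult_mat_vec_carrier[OF C v]] by simp

lemma mat_adjoint_mult:
  fixes A B :: "complex mat"
  assumes A: "A \<in> carrier_mat n m" and B: "B \<in> carrier_mat m l"
  shows "mat_adjoint (A * B) = mat_adjoint B * mat_adjoint A"
proof (rule mat_adjoint_eqI)
  show "A * B \<in> carrier_mat n l" "mat_adjoint B * mat_adjoint A \<in> carrier_mat l n"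
    using A B by auto
  fix i j assume "i < l" "j < n"
  then show "(mat_adjoint B * mat_adjoint A) $$ (i, j) = cnj ((A * B) $$ (j, i))"
    by (auto simp: mult_mat_index_sum[OF mat_adjoint_carrier[OF B] mat_adjoint_carrier[OF A]]
        mult_mat_index_sum[OF A B] mat_adjoint_index[OF A] mat_adjoint_index[OF B]
        mult.commute intro!: sum.cong)
qed

lemma cscalar_prod_sum:
  fixes v w :: "complex vec"
  assumes "v \<in> carrier_vec n" "w \<in> carrier_vec n"
  shows "v \<bullet>c w = (\<Sum>i<n. v $ i * cnj (w $ i))"
  using assms by (auto simp: scalar_prod_def lessThan_atLeast0 intro!: sum.cong)

lemma cscalar_prod_adjoint:
  fixes A :: "complex mat"
  assumes A: "A \<in> carrier_mat n m" and x: "x \<in> carrier_vec m" and y: "y \<in> carrier_vec n"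
  shows "(A *\<^sub>v x) \<bullet>c y = x \<bullet>c (mat_adjoint A *\<^sub>v y)"
proof -
  have "(A *\<^sub>v x) \<bullet>c y = (\<Sum>i<n. \<Sum>k<m. A $$ (i, k) * x $ k * cnj (y $ i))"
    by (subst cscalar_prod_sum[of _ n])
      (use A x y in \<open>auto simp: mult_mat_vec_index_sum[OF A x] sum_distrib_right simp del: index_mult_mat_vec\<close>)
  also have "\<dots> = (\<Sum>k<m. \<Sum>i<n. A $$ (i, k) * x $ k * cnj (y $ i))"
    by (rule sum.swap)
  also have "\<dots> = x \<bullet>c (mat_adjoint A *\<^sub>v y)"
    by (subst cscalar_prod_sum[of _ m])
      (use x mult_mat_vec_carrier[OF mat_adjoint_carrier[OF A] y] in
        \<open>auto simp: mult_mat_vec_index_sum[OF mat_adjoint_carrier[OF A] y] mat_adjoint_index[OF A]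
          sum_distrib_left mult_ac simp del: index_mult_mat_vec intro!: sum.cong\<close>)
  finally show ?thesis .
qed

text \<open>The adjoint reverses the three factors and fixes \<open>A\<close>. The matrix
  \<open>W\<close> may be rectangular, so the lemma covers both a unitary change of basis and the
  compression by an isometry.\<close>

lemma adjoint_congruence_hermitian:
  assumes A: "A \<in> carrier_mat n n" "hermitian_mat A" and W: "W \<in> carrier_mat n m"
  shows "hermitian_mat (mat_adjoint W * A * W)"
proof -
  note W' = mat_adjoint_carrier[OF W]
  have "mat_adjoint (mat_adjoint W * A * W) = mat_adjoint W * (A * W)"
    using A(2) mat_adjoint_mult[OF mult_carrier_mat[OF W' A(1)] W] mat_adjoint_mult[OF W' A(1)]
    by (simp add: hermitian_mat_def)
  then show ?thesis
    using assoc_mult_mat[OF W' A(1) W] by (simp add: hermitian_mat_def)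
qed

section \<open>Unitary matrices and unitary diagonalization\<close>

text \<open>One product suffices as an encoding: a left inverse of a square matrix is also a right
  inverse, which \<open>unitary_matD\<close> makes available.\<close>

definition unitary_mat :: "nat \<Rightarrow> complex mat \<Rightarrow> bool" where
  "unitary_mat n U \<longleftrightarrow> U \<in> carrier_mat n n \<and> mat_adjoint U * U = 1\<^sub>m n"

lemma unitary_matD:
  assumes "unitary_mat n U"
  shows "U \<in> carrier_mat n n" "mat_adjoint U * U = 1\<^sub>m n" "U * mat_adjoint U = 1\<^sub>m n"
proof -
  show U: "U \<in> carrier_mat n n" "mat_adjoint U * U = 1\<^sub>m n"
    using assms by (simp_all add: unitary_mat_def)
  show "U * mat_adjoint U = 1\<^sub>m n"
    by (rule mat_mult_left_right_inverse[OF mat_adjoint_carrier[OF U(1)] U])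
qed

lemma unitary_mat_mult:
  assumes U: "unitary_mat n U" and V: "unitary_mat n V"
  shows "unitary_mat n (U * V)"
proof -
  note u = unitary_matD[OF U] and v = unitary_matD[OF V]
  have "mat_adjoint (U * V) * (U * V) = mat_adjoint V * (mat_adjoint U * (U * V))"
    unfolding mat_adjoint_mult[OF u(1) v(1)]
    by (rule assoc_mult_mat[OF mat_adjoint_carrier[OF v(1)] mat_adjoint_carrier[OF u(1)]
          mult_carrier_mat[OF u(1) v(1)]])
  also have "mat_adjoint U * (U * V) = V"
    using u v(1) assoc_mult_mat[OF mat_adjoint_carrier[OF u(1)] u(1) v(1)] by simp
  finally show ?thesis
    using v(2) mult_carrier_mat[OF u(1) v(1)] by (simp add: unitary_mat_def)
qed

text \<open>
  \<^const>\<open>schur_decomposition\<close> gives only similarity to a triangular matrix, without a unitary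
  change of basis, so its deflation argument is repeated here with a unitary one.
\<close>

lemma unitary_first_column:
  assumes v: "v \<in> carrier_vec n" "v \<noteq> 0\<^sub>v n" and n: "0 < n"
  obtains W c where "unitary_mat n W" "col W 0 = c \<cdot>\<^sub>v v"
proof -
  define b where "b = basis_completion v"
  define ws where "ws = gram_schmidt n b"
  interpret cof_vec_space n "TYPE(complex)" .
  note bc = basis_completion[OF v, folded b_def]
  from bc(6,7) n obtain vs where bv: "b = v # vs" by (cases b) auto
  have ws: "set ws \<subseteq> carrier_vec n" "corthogonal ws" "length ws = n"
    using gram_schmidt_result[OF bc(2,4,5) ws_def] bc(6) by auto
  \<comment> \<open>Gram-Schmidt leaves the first vector of its input unchanged, so \<open>v\<close>
    survives as the direction of column 0.\<close>
  have "hd ws = v" using gram_schmidt_hd[OF v(1), of vs, folded bv] by (simp add: ws_def)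
  with ws(3) n have ws0: "ws ! 0 = v" by (cases ws) auto
  have wsc: "ws ! i \<in> carrier_vec n" if "i < n" for i using ws that by auto
  \<comment> \<open>The vectors \<open>ws\<close> are orthogonal but not normalized;
    \<open>s j\<close> is the inverse length of the \<open>j\<close>-th one. It is real, so
    conjugation does not affect it.\<close>
  define s where "s j = complex_of_real (1 / sqrt (Re (ws ! j \<bullet>c ws ! j)))" for j
  have cnj_s: "cnj (s j) = s j" for j by (simp add: s_def)
  define W where "W = mat n n (\<lambda>(i, j). s j * ws ! j $ i)"
  have W: "W \<in> carrier_mat n n" by (simp add: W_def)
  have "mat_adjoint W * W = 1\<^sub>m n"
  proof (rule eq_matI)
    fix i j assume ij: "i < dim_row (1\<^sub>m n :: complex mat)" "j < dim_col (1\<^sub>m n :: complex mat)"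
    then have ij: "i < n" "j < n" by auto
    have "(mat_adjoint W * W) $$ (i, j) = (\<Sum>k<n. cnj (W $$ (k, i)) * W $$ (k, j))"
      using ij by (subst mult_mat_index_sum[OF mat_adjoint_carrier[OF W] W])
        (auto simp: mat_adjoint_index[OF W])
    also have "\<dots> = s i * s j * (ws ! j \<bullet>c ws ! i)"
      using ij by (subst cscalar_prod_sum[OF wsc wsc])
        (auto simp: W_def cnj_s sum_distrib_left mult_ac intro!: sum.cong)
    also have "\<dots> = (1\<^sub>m n) $$ (i, j)"
    proof (cases "i = j")
      case True
      \<comment> \<open>Nonnegativity in the order on complex numbers includes a vanishing imaginary
        part. Hence the squared norm equals its real part, which is positive, and \<open>s i\<close>
        is its inverse square root.\<close>
      have "ws ! i \<bullet>c ws ! i \<noteq> 0" using ws ij corthogonalD[OF ws(2)] by auto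
      moreover have "ws ! i \<bullet>c ws ! i \<ge> 0" by (rule conjugate_square_ge_0_vec)
      ultimately have "ws ! i \<bullet>c ws ! i = complex_of_real (Re (ws ! i \<bullet>c ws ! i))"
          "Re (ws ! i \<bullet>c ws ! i) > 0"
        by (auto simp: complex_eq_iff less_eq_complex_def)
      moreover have "s i * s i = complex_of_real (1 / Re (ws ! i \<bullet>c ws ! i))"
        using calculation(2) unfolding s_def of_real_mult[symmetric] by simp
      ultimately show ?thesis using True ij
        by (metis (no_types, lifting) index_one_mat(1) less_irrefl nonzero_eq_divide_eq of_real_1 of_real_mult times_divide_eq_left)
    next
      case False
      then show ?thesis using ws ij corthogonalD[OF ws(2)] by auto
    qed
    finally show "(mat_adjoint W * W) $$ (i, j) = 1\<^sub>m n $$ (i, j)" .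
  qed (use W mat_adjoint_carrier[OF W] in auto)
  moreover have "col W 0 = s 0 \<cdot>\<^sub>v v"
    using n v by (auto simp: W_def ws0)
  ultimately show thesis using that W by (auto simp: unitary_mat_def)
qed

text \<open>Induction on the list of roots: splitting off a unit eigenvector leaves a Hermitian
  block of size one less whose roots are the tail of the list. Taking the roots in the order of
  \<open>es\<close> fixes the order on the diagonal, so a sorted list gives a sorted
  diagonal.\<close>

lemma hermitian_unitary_diagonalization:
  assumes "A \<in> carrier_mat n n" "hermitian_mat A" "char_poly A = (\<Prod>e\<leftarrow>es. [:- e, 1:])"
  obtains U where "unitary_mat n U" "mat_adjoint U * A * U = mat_diag n ((!) es)"
proof -
  have "\<exists>U. unitary_mat n U \<and> mat_adjoint U * A * U = mat_diag n ((!) es)"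
    using assms
  proof (induction es arbitrary: n A)
    case Nil
    then have "n = 0" using degree_monic_char_poly[of A n] by simp
    then show ?case using Nil.prems(1)
      by (intro exI[of _ "1\<^sub>m 0"]) (auto simp: unitary_mat_def mat_diag_def intro!: eq_matI)
  next
    case (Cons e es)
    note A = Cons.prems(1) and H = Cons.prems(2) and cp = Cons.prems(3)
    have ev: "eigenvalue A e" unfolding eigenvalue_root_char_poly[OF A] cp by simp
    have "degree (char_poly A) = length (e # es)"
      unfolding cp by (rule degree_linear_factors)
    then obtain m where n: "n = Suc m" using degree_monic_char_poly[OF A] by auto
    from ev obtain v where v: "v \<in> carrier_vec n" "v \<noteq> 0\<^sub>v n" and Av: "A *\<^sub>v v = e \<cdot>\<^sub>v v"
      using A unfolding eigenvalue_def eigenvector_def by auto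
    obtain W c where "unitary_mat n W" and W0: "col W 0 = c \<cdot>\<^sub>v v"
      using unitary_first_column[OF v] n by auto
    note W = unitary_matD[OF this(1)] and Wa = mat_adjoint_carrier[OF unitary_matD(1)[OF this(1)]]
    define B where "B = mat_adjoint W * A * W"
    have B: "B \<in> carrier_mat n n" and HB: "hermitian_mat B"
      using A H W(1) adjoint_congruence_hermitian[OF A H W(1)] by (auto simp: B_def)
    \<comment> \<open>Column 0 of \<open>W\<close> is an eigenvector for \<open>e\<close>, so column
      0 of \<open>B\<close> is \<open>e\<close> times column 0 of \<open>mat_adjoint W * W\<close>,
      the identity.\<close>
    have B0: "B $$ (i, 0) = (if i = 0 then e else 0)" if "i < n" for i
    proof -
      have "A *\<^sub>v col W 0 = e \<cdot>\<^sub>v col W 0"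
        unfolding W0 using A v Av by (auto simp: mult_mat_vec smult_smult_assoc mult.commute)
      then have AW: "col (A * W) 0 = e \<cdot>\<^sub>v col W 0"
        using n by (simp only: col_mult2[OF A W(1)])
      have "B $$ (i, 0) = row (mat_adjoint W) i \<bullet> col (A * W) 0"
        unfolding B_def assoc_mult_mat[OF Wa A W(1)]
        using that n A W(1) by (intro index_mult_mat(1)) auto
      also have "\<dots> = row (mat_adjoint W) i \<bullet> (e \<cdot>\<^sub>v col W 0)" by (simp only: AW)
      also have "\<dots> = e * (mat_adjoint W * W) $$ (i, 0)"
        using that n W(1) Wa by simp
      finally show ?thesis using that n by (simp add: W(2))
    qed
    \<comment> \<open>Hermitian symmetry and the reality of \<open>e\<close> carry this over to row
      0, so \<open>B\<close> is block diagonal and not merely block triangular.\<close>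
    have B0': "B $$ (0, i) = (if i = 0 then e else 0)" if "i < n" for i
    proof -
      have "B $$ (0, i) = cnj (B $$ (i, 0))"
        using HB that n unfolding hermitian_mat_iff[OF B] by blast
      moreover have "cnj e = e"
        using hermitian_eigenvalue_real[OF A H ev] by (simp add: Reals_cnj_iff)
      ultimately show ?thesis using B0[OF that] by simp
    qed
    define A1 where "A1 = mat 1 1 (\<lambda>_. e)"
    define C where "C = mat m m (\<lambda>(i, j). B $$ (Suc i, Suc j))"
    have A1: "A1 \<in> carrier_mat 1 1" and C: "C \<in> carrier_mat m m" by (auto simp: A1_def C_def)
    have Bb: "B = four_block_mat A1 (0\<^sub>m 1 m) (0\<^sub>m m 1) C"
      using B n B0 B0' by (intro eq_matI) (auto simp: A1_def C_def)
    have HC: "hermitian_mat C"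
      unfolding hermitian_mat_iff[OF C]
    proof (intro allI impI)
      fix i j assume "i < m" "j < m"
      moreover from this have "B $$ (Suc i, Suc j) = cnj (B $$ (Suc j, Suc i))"
        using HB n unfolding hermitian_mat_iff[OF B] by blast
      ultimately show "C $$ (i, j) = cnj (C $$ (j, i))" by (simp add: C_def)
    qed
    \<comment> \<open>Similarity preserves the characteristic polynomial; cancelling the factor of
      the 1 by 1 block leaves exactly the factors of \<open>es\<close> for \<open>C\<close>.\<close>
    have "similar_mat B A"
      unfolding similar_mat_def
      by (intro exI[of _ "mat_adjoint W"] exI[of _ W] similar_mat_witI[of _ _ n])
        (use A B W Wa in \<open>auto simp: B_def\<close>)
    then have "char_poly B = char_poly A" by (rule char_poly_similar)
    moreover have "char_poly B = char_poly A1 * char_poly C"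
      unfolding Bb by (rule char_poly_four_block_zeros_col[OF A1 zero_carrier_mat C])
    ultimately have "char_poly A1 * char_poly C = [:- e, 1:] * (\<Prod>e\<leftarrow>es. [:- e, 1:])"
      unfolding cp by simp
    moreover have "char_poly A1 = [:- e, 1:]"
      by (simp add: A1_def char_poly_defs det_def sign_def)
    ultimately have "char_poly C = (\<Prod>e\<leftarrow>es. [:- e, 1:])"
      by (metis mult_cancel_left pCons_eq_0_iff zero_neq_one)
    from Cons.IH[OF C HC this] obtain V where V: "unitary_mat m V"
      and VC: "mat_adjoint V * C * V = mat_diag m ((!) es)" by blast
    note v = unitary_matD[OF V] and va = mat_adjoint_carrier[OF unitary_matD(1)[OF V]]
    \<comment> \<open>The unitary \<open>V\<close> that diagonalizes \<open>C\<close> is extended by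
      1 in the split-off direction. The product \<open>W * V'\<close> then diagonalizes
      \<open>A\<close>, since \<open>W\<close> turns \<open>A\<close> into \<open>B\<close> and
      \<open>V'\<close> diagonalizes \<open>B\<close>.\<close>
    define V' where "V' = four_block_mat (1\<^sub>m 1) (0\<^sub>m 1 m) (0\<^sub>m m 1) V"
    have V': "V' \<in> carrier_mat n n"
      using four_block_carrier_mat[OF one_carrier_mat v(1), of 1] by (simp add: V'_def n)
    have V'a: "mat_adjoint V' = four_block_mat (1\<^sub>m 1) (0\<^sub>m 1 m) (0\<^sub>m m 1) (mat_adjoint V)"
      using V' v(1) va n
      by (intro mat_adjoint_eqI[OF V']) (auto simp: V'_def mat_adjoint_index[OF v(1)])
    have "mat_adjoint V' * V' = 1\<^sub>m n"
      unfolding V'a unfolding V'_def using v va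
      by (subst mult_four_block_mat[of _ 1 1 _ m _ m _ _ 1 _ m]) (auto simp: n)
    then have "unitary_mat n V'" using V' by (simp add: unitary_mat_def)
    moreover have "mat_adjoint V' * B * V' = mat_diag n ((!) (e # es))"
    proof -
      have "mat_adjoint V' * B = four_block_mat A1 (0\<^sub>m 1 m) (0\<^sub>m m 1) (mat_adjoint V * C)"
        unfolding V'a Bb using v va A1 C
        by (subst mult_four_block_mat[of _ 1 1 _ m _ m _ _ 1 _ m]) auto
      then have "mat_adjoint V' * B * V'
          = four_block_mat A1 (0\<^sub>m 1 m) (0\<^sub>m m 1) (mat_adjoint V * C * V)"
        unfolding V'_def using v va A1 C
        by (simp, subst mult_four_block_mat[of _ 1 1 _ m _ m _ _ 1 _ m]) auto
      then show ?thesis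
        unfolding VC n by (auto simp: A1_def nth_Cons' mat_diag_def intro!: eq_matI)
    qed
    ultimately show ?case
      using \<open>unitary_mat n W\<close> A W(1) Wa V' mat_adjoint_mult[OF W(1) V']
      by (intro exI[of _ "W * V'"] conjI unitary_mat_mult)
        (auto simp: B_def assoc_mult_mat[of _ n n _ n _ n] mult_carrier_mat[of _ n n _ n])
  qed
  then show thesis using that by blast
qed


section \<open>Quadratic forms in eigenvector coordinates\<close>

text \<open>A monic complex polynomial is the product of its linear factors. Listing them by
  increasing eigenvalue makes the diagonal entries agree with
  \<open>eigenvalue_list\<close>.\<close>

lemma char_poly_hermitian:
  assumes A: "A \<in> carrier_mat n n" and H: "hermitian_mat A"
  shows "char_poly A = (\<Prod>e\<leftarrow>map complex_of_real (eigenvalue_list A). [:- e, 1:])"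
proof -
  have "char_poly A = (\<Prod>e\<in>#proots (char_poly A). [:- e, 1:])"
    using complex_poly_decompose_multiset[of "char_poly A"] degree_monic_char_poly[OF A] by simp
  also have "proots (char_poly A) = mset (map complex_of_real (eigenvalue_list A))"
    using hermitian_eigenvalue_list(3)[OF A H] by simp
  finally show ?thesis by (simp only: prod_mset_prod_list flip: mset_map)
qed

text \<open>In the coordinates of an orthonormal eigenbasis the form is diagonal and the norm keeps
  its shape. The same \<open>U\<close> serves both identities, which makes Rayleigh quotients
  weighted means of eigenvalues.\<close>

lemma hermitian_spectral_form:
  assumes A: "A \<in> carrier_mat n n" and H: "hermitian_mat A"
  obtains U where "U \<in> carrier_mat n n"
    "\<forall>x\<in>carrier_vec n.
      (A *\<^sub>v x) \<bullet>c x = of_real (\<Sum>i<n. eigenvalue_list A ! i * (cmod ((U *\<^sub>v x) $ i))\<^sup>2)"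
    "\<forall>x\<in>carrier_vec n. x \<bullet>c x = of_real (\<Sum>i<n. (cmod ((U *\<^sub>v x) $ i))\<^sup>2)"
proof -
  let ?es = "map complex_of_real (eigenvalue_list A)"
  let ?D = "mat_diag n ((!) ?es)"
  obtain U where "unitary_mat n U" and D: "mat_adjoint U * A * U = ?D"
    using hermitian_unitary_diagonalization[OF A H char_poly_hermitian[OF A H]] .
  note U = unitary_matD[OF this(1)]
  note Ua = mat_adjoint_carrier[OF U(1)]
  \<comment> \<open>The witness is the adjoint of the diagonalizing matrix: it sends a vector to its
    coordinates in the eigenbasis.\<close>
  show thesis
  proof (rule that[OF Ua]; rule ballI)
    fix x :: "complex vec" assume x: "x \<in> carrier_vec n"
    define y where "y = mat_adjoint U *\<^sub>v x"
    have y: "y \<in> carrier_vec n" using Ua x by (simp add: y_def)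
    have xy: "x = U *\<^sub>v y"
      using x assoc_mult_mat_vec[OF U(1) Ua x] by (simp add: y_def U(3))
    show "x \<bullet>c x = of_real (\<Sum>i<n. (cmod ((mat_adjoint U *\<^sub>v x) $ i))\<^sup>2)"
    proof -
      have "x \<bullet>c x = y \<bullet>c y"
        using cscalar_prod_adjoint[OF U(1) y x] by (simp flip: xy y_def)
      then show ?thesis
        by (simp add: cscalar_prod_sum[OF y y] complex_norm_square del: of_real_power flip: y_def)
    qed
    show "(A *\<^sub>v x) \<bullet>c x
        = of_real (\<Sum>i<n. eigenvalue_list A ! i * (cmod ((mat_adjoint U *\<^sub>v x) $ i))\<^sup>2)"
    proof -
      have Ax: "A *\<^sub>v x \<in> carrier_vec n" using A x by simp
      have Dy: "(?D *\<^sub>v y) $ i = eigenvalue_list A ! i * y $ i" if "i < n" for i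
      proof -
        have "(?D *\<^sub>v y) $ i = (\<Sum>k<n. if k = i then eigenvalue_list A ! i * y $ i else 0)"
          unfolding mult_mat_vec_index_sum[OF mat_diag_dim y that]
          using that hermitian_eigenvalue_list(2)[OF A H]
          by (intro sum.cong) (auto simp: mat_diag_def)
        then show ?thesis using that by simp
      qed
      have "?D *\<^sub>v y = mat_adjoint U *\<^sub>v (A *\<^sub>v x)"
        unfolding D[symmetric] mult_mat3_vec[OF Ua A U(1) y] by (simp flip: xy)
      then have "(A *\<^sub>v x) \<bullet>c x = (?D *\<^sub>v y) \<bullet>c y"
        using cscalar_prod_adjoint[OF Ua Ax y] by (simp flip: xy)
      also have "\<dots> = (\<Sum>i<n. eigenvalue_list A ! i * y $ i * cnj (y $ i))"
        unfolding cscalar_prod_sum[OF mult_mat_vec_carrier[OF mat_diag_dim y] y]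
        by (intro sum.cong) (auto simp: Dy simp del: index_mult_mat_vec)
      finally show ?thesis
        by (simp add: complex_norm_square mult.assoc del: of_real_power flip: y_def)
    qed
  qed
qed

section \<open>Interlacing for compressions by an isometry\<close>

text \<open>Putting a zero row in place of form \<open>k\<close> makes the square matrix of the
  forms singular, and any nonzero kernel vector works. This is the dimension count for
  \<open>n - 1\<close> equations in \<open>n\<close> unknowns.\<close>

lemma common_zero_of_linear_forms:
  fixes f :: "nat \<Rightarrow> 'a :: idom vec"
  assumes f: "\<And>i. i < n \<Longrightarrow> f i \<in> carrier_vec n" and k: "k < n"
  obtains z where "z \<in> carrier_vec n" "z \<noteq> 0\<^sub>v n" "\<And>i. i < n \<Longrightarrow> i \<noteq> k \<Longrightarrow> f i \<bullet> z = 0"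
proof -
  define M where "M = mat\<^sub>r n n (\<lambda>i. if i = k then 0\<^sub>v n else f i)"
  have "det M = 0" unfolding M_def using f k by (intro det_row_0) auto
  moreover have M: "M \<in> carrier_mat n n" by (simp add: M_def)
  ultimately obtain z where z: "z \<in> carrier_vec n" "z \<noteq> 0\<^sub>v n" and Mz: "M *\<^sub>v z = 0\<^sub>v n"
    using det_0_iff_vec_prod_zero by blast
  have "f i \<bullet> z = 0" if "i < n" "i \<noteq> k" for i
  proof -
    have "f i \<bullet> z = (M *\<^sub>v z) $ i" using that f by (simp add: M_def)
    then show ?thesis using that by (simp add: Mz)
  qed
  with z that show thesis by blast
qed

text \<open>Rayleigh quotient bounds, with \<open>l\<close> the eigenvalues and \<open>w\<close> the
  squared moduli of coordinates. Only indices of nonzero weight constrain \<open>l\<close>, so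
  making coordinates vanish removes the unwanted eigenvalues.\<close>

lemma weighted_sum_bounds:
  fixes w :: "nat \<Rightarrow> real"
  assumes "\<And>i. i < n \<Longrightarrow> 0 \<le> w i"
  shows "(\<And>i. i < n \<Longrightarrow> w i \<noteq> 0 \<Longrightarrow> c \<le> l i) \<Longrightarrow> c * (\<Sum>i<n. w i) \<le> (\<Sum>i<n. l i * w i)"
    and "(\<And>i. i < n \<Longrightarrow> w i \<noteq> 0 \<Longrightarrow> l i \<le> c) \<Longrightarrow> (\<Sum>i<n. l i * w i) \<le> c * (\<Sum>i<n. w i)"
proof -
  show "c * (\<Sum>i<n. w i) \<le> (\<Sum>i<n. l i * w i)" if "\<And>i. i < n \<Longrightarrow> w i \<noteq> 0 \<Longrightarrow> c \<le> l i"
  proof -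
    have "c * w i \<le> l i * w i" if "i < n" for i
      using \<open>\<And>i. i < n \<Longrightarrow> w i \<noteq> 0 \<Longrightarrow> c \<le> l i\<close> assms that
      by (cases "w i = 0") (auto intro: mult_right_mono)
    then show ?thesis unfolding sum_distrib_left by (intro sum_mono) simp
  qed
  show "(\<Sum>i<n. l i * w i) \<le> c * (\<Sum>i<n. w i)" if "\<And>i. i < n \<Longrightarrow> w i \<noteq> 0 \<Longrightarrow> l i \<le> c"
  proof -
    have "l i * w i \<le> c * w i" if "i < n" for i
      using \<open>\<And>i. i < n \<Longrightarrow> w i \<noteq> 0 \<Longrightarrow> l i \<le> c\<close> assms that
      by (cases "w i = 0") (auto intro: mult_right_mono)
    then show ?thesis unfolding sum_distrib_left by (intro sum_mono) simp
  qed
qed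

text \<open>With an isometry in place of an index set, both inequalities become dimension counts for
  forms on the space of dimension \<open>r\<close>.\<close>

theorem poincare_separation:
  assumes A: "A \<in> carrier_mat n n" and H: "hermitian_mat A"
    and E: "E \<in> carrier_mat n r" and iso: "mat_adjoint E * E = 1\<^sub>m r"
    and r: "r \<le> n" and k: "k \<in> {1..r}"
  defines "B \<equiv> mat_adjoint E * A * E"
  shows "ordered_eigenvalue k A \<le> ordered_eigenvalue k B"
    and "ordered_eigenvalue k B \<le> ordered_eigenvalue (k + n - r) A"
proof -
  note Ea = mat_adjoint_carrier[OF E]
  have B: "B \<in> carrier_mat r r" and HB: "hermitian_mat B"
    using A E Ea adjoint_congruence_hermitian[OF A H E] by (auto simp: B_def)
  obtain U where U: "U \<in> carrier_mat n n"
    and UA: "\<forall>x\<in>carrier_vec n.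
      (A *\<^sub>v x) \<bullet>c x = of_real (\<Sum>i<n. eigenvalue_list A ! i * (cmod ((U *\<^sub>v x) $ i))\<^sup>2)"
    and U1: "\<forall>x\<in>carrier_vec n. x \<bullet>c x = of_real (\<Sum>i<n. (cmod ((U *\<^sub>v x) $ i))\<^sup>2)"
    using hermitian_spectral_form[OF A H] .
  obtain V where V: "V \<in> carrier_mat r r"
    and VB: "\<forall>x\<in>carrier_vec r.
      (B *\<^sub>v x) \<bullet>c x = of_real (\<Sum>i<r. eigenvalue_list B ! i * (cmod ((V *\<^sub>v x) $ i))\<^sup>2)"
    and V1: "\<forall>x\<in>carrier_vec r. x \<bullet>c x = of_real (\<Sum>i<r. (cmod ((V *\<^sub>v x) $ i))\<^sup>2)"
    using hermitian_spectral_form[OF B HB] .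
  \<comment> \<open>These are the squared moduli of the coordinates of \<open>E z\<close> in the
    eigenbasis of \<open>A\<close> and of \<open>z\<close> in that of \<open>B\<close>.\<close>
  define a where "a z i = (cmod ((U *\<^sub>v (E *\<^sub>v z)) $ i))\<^sup>2" for z i
  define b where "b z i = (cmod ((V *\<^sub>v z) $ i))\<^sup>2" for z i
  have quad: "(\<Sum>i<n. eigenvalue_list A ! i * a z i) = (\<Sum>i<r. eigenvalue_list B ! i * b z i)"
    if z: "z \<in> carrier_vec r" for z
  proof -
    have Ez: "E *\<^sub>v z \<in> carrier_vec n" using E z by simp
    have "B *\<^sub>v z = mat_adjoint E *\<^sub>v (A *\<^sub>v (E *\<^sub>v z))"
      unfolding B_def by (rule mult_mat3_vec[OF Ea A E z])
    then have "(B *\<^sub>v z) \<bullet>c z = (A *\<^sub>v (E *\<^sub>v z)) \<bullet>c (E *\<^sub>v z)"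
      using cscalar_prod_adjoint[OF Ea mult_mat_vec_carrier[OF A Ez] z] by simp
    then show ?thesis
      unfolding bspec[OF UA Ez] bspec[OF VB z] a_def b_def of_real_eq_iff by simp
  qed
  have total: "(\<Sum>i<n. a z i) = (\<Sum>i<r. b z i)" if z: "z \<in> carrier_vec r" for z
  proof -
    have Ez: "E *\<^sub>v z \<in> carrier_vec n" using E z by simp
    have "mat_adjoint E *\<^sub>v (E *\<^sub>v z) = z"
      using assoc_mult_mat_vec[OF Ea E z] z by (simp add: iso)
    then have "(E *\<^sub>v z) \<bullet>c (E *\<^sub>v z) = z \<bullet>c z"
      using cscalar_prod_adjoint[OF E z Ez] by simp
    then show ?thesis
      unfolding bspec[OF U1 Ez] bspec[OF V1 z] a_def b_def of_real_eq_iff .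
  qed
  \<comment> \<open>Strict positivity allows the common total weight to be cancelled from the final
    inequalities.\<close>
  have pos: "(\<Sum>i<r. b z i) > 0" if z: "z \<in> carrier_vec r" "z \<noteq> 0\<^sub>v r" for z
  proof -
    have "(\<Sum>i<r. b z i) \<noteq> 0"
      using bspec[OF V1 z(1)] conjugate_square_eq_0_vec[OF z(1)] z(2) unfolding b_def
      by (metis of_real_0)
    moreover have "(\<Sum>i<r. b z i) \<ge> 0" by (intro sum_nonneg) (simp add: b_def)
    ultimately show ?thesis by linarith
  qed
  have UE: "row (U * E) i \<in> carrier_vec r" if "i < n" for i
    using that U E by (intro row_carrier_vec) auto
  \<comment> \<open>A coordinate of \<open>E z\<close> is a linear form in \<open>z\<close>, so the
    conditions for \<open>A\<close> and for \<open>B\<close> can be mixed in a single system on the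
    smaller space.\<close>
  have UEz: "row (U * E) i \<bullet> z = (U *\<^sub>v (E *\<^sub>v z)) $ i" if "i < n" "z \<in> carrier_vec r" for i z
    using that U E index_mult_mat_vec[of i "U * E" z] assoc_mult_mat_vec[OF U E that(2)]
    by (simp del: index_mult_mat_vec row_mult)
  have Vrow: "row V i \<in> carrier_vec r" "row V i \<bullet> z = (V *\<^sub>v z) $ i" if "i < r" for i z
    using that V by auto
  have mono: "eigenvalue_list A ! i \<le> eigenvalue_list A ! j" if "i \<le> j" "j < n" for i j
    using hermitian_eigenvalue_list[OF A H] that by (simp add: sorted_nth_mono)
  have monoB: "eigenvalue_list B ! i \<le> eigenvalue_list B ! j" if "i \<le> j" "j < r" for i j
    using hermitian_eigenvalue_list[OF B HB] that by (simp add: sorted_nth_mono)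
  have k': "k - 1 < r" using k by auto

  show "ordered_eigenvalue k A \<le> ordered_eigenvalue k B"
  proof -
    \<comment> \<open>Slots below \<open>k - 1\<close> kill the low coordinates for
      \<open>A\<close>, slots above it the high ones for \<open>B\<close>; slot \<open>k - 1\<close>
      stays free. The surviving indices are at least \<open>k - 1\<close> for \<open>A\<close> and
      at most \<open>k - 1\<close> for \<open>B\<close>.\<close>
    obtain z where z: "z \<in> carrier_vec r" "z \<noteq> 0\<^sub>v r"
      and z0: "\<And>i. i < r \<Longrightarrow> i \<noteq> k - 1 \<Longrightarrow> (if i < k - 1 then row (U * E) i else row V i) \<bullet> z = 0"
      by (rule common_zero_of_linear_forms[of r "\<lambda>i. if i < k - 1 then row (U * E) i else row V i",
            OF _ k']) (use UE Vrow(1) r in auto)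
    have az: "a z i = 0" if "i < k - 1" for i
      using z0[of i] that UEz[OF _ z(1), of i] k r by (auto simp: a_def)
    have bz: "b z i = 0" if "k - 1 < i" "i < r" for i
      using z0[of i] that Vrow(2)[of i z] by (auto simp: b_def)
    have "eigenvalue_list A ! (k - 1) * (\<Sum>i<n. a z i) \<le> (\<Sum>i<n. eigenvalue_list A ! i * a z i)"
      by (rule weighted_sum_bounds(1)) (simp add: a_def, metis az mono not_less)
    also have "\<dots> = (\<Sum>i<r. eigenvalue_list B ! i * b z i)" by (rule quad[OF z(1)])
    also have "\<dots> \<le> eigenvalue_list B ! (k - 1) * (\<Sum>i<r. b z i)"
      by (rule weighted_sum_bounds(2)) (simp add: b_def, metis bz monoB k' not_less)
    finally show ?thesis
      using pos[OF z] by (simp add: total[OF z(1)] ordered_eigenvalue_def)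
  qed

  show "ordered_eigenvalue k B \<le> ordered_eigenvalue (k + n - r) A"
  proof -
    \<comment> \<open>The 0-based position of eigenvalue number \<open>k + n - r\<close>; since
      \<open>1 \<le> k\<close> and \<open>r \<le> n\<close>, no subtraction is truncated.\<close>
    let ?m = "k + n - r - 1"
    have m: "?m < n" using k r by auto
    \<comment> \<open>The roles are exchanged. The shift by \<open>n - r\<close> maps the slots
      \<open>k, ..., r - 1\<close> onto the positions \<open>?m + 1, ..., n - 1\<close>, which are
      exactly the high coordinates for \<open>A\<close>.\<close>
    obtain z where z: "z \<in> carrier_vec r" "z \<noteq> 0\<^sub>v r"
      and z0: "\<And>i. i < r \<Longrightarrow> i \<noteq> k - 1 \<Longrightarrow>
        (if i < k - 1 then row V i else row (U * E) (i + (n - r))) \<bullet> z = 0"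
      by (rule common_zero_of_linear_forms[of r
            "\<lambda>i. if i < k - 1 then row V i else row (U * E) (i + (n - r))", OF _ k'])
        (use UE Vrow(1) r in auto)
    have bz: "b z i = 0" if "i < k - 1" for i
      using z0[of i] that Vrow(2)[of i z] k by (auto simp: b_def)
    have az: "a z i = 0" if "?m < i" "i < n" for i
    proof -
      have "i - (n - r) < r" "k - 1 < i - (n - r)" "i - (n - r) + (n - r) = i"
        using that k r by auto
      then show ?thesis
        using z0[of "i - (n - r)"] UEz[OF that(2) z(1)] by (auto simp: a_def)
    qed
    have "eigenvalue_list B ! (k - 1) * (\<Sum>i<r. b z i) \<le> (\<Sum>i<r. eigenvalue_list B ! i * b z i)"
      by (rule weighted_sum_bounds(1)) (simp add: b_def, metis bz monoB not_less)
    also have "\<dots> = (\<Sum>i<n. eigenvalue_list A ! i * a z i)" by (rule quad[OF z(1), symmetric])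
    also have "\<dots> \<le> eigenvalue_list A ! ?m * (\<Sum>i<n. a z i)"
      by (rule weighted_sum_bounds(2)) (simp add: a_def, metis az mono m not_less)
    finally show ?thesis
      using pos[OF z] by (simp add: total[OF z(1)] ordered_eigenvalue_def)
  qed
qed

section \<open>Principal submatrices and the pointwise conclusion\<close>

text \<open>The columns of \<open>E\<close> are the standard basis vectors indexed by
  \<open>I\<close>, in increasing order. They are orthonormal, and sandwiching \<open>A\<close>
  between \<open>E\<close> and its adjoint selects the retained rows and columns.\<close>

lemma submatrix_as_congruence:
  fixes A :: "complex mat"
  assumes A: "A \<in> carrier_mat n n" and I: "I \<subseteq> {..<n}" "card I = r"
  obtains E where "E \<in> carrier_mat n r" "mat_adjoint E * E = 1\<^sub>m r"
    "submatrix A I I = mat_adjoint E * A * E"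
proof -
  define E :: "complex mat" where "E = mat n r (\<lambda>(i, j). if i = pick I j then 1 else 0)"
  have E: "E \<in> carrier_mat n r" by (simp add: E_def)
  note Ea = mat_adjoint_carrier[OF E]
  have adjE: "mat_adjoint E $$ (i, j) = (if j = pick I i then 1 else 0)" if "i < r" "j < n" for i j
    unfolding mat_adjoint_index[OF E that] using that by (simp add: E_def)
  have pick: "pick I j < n" if "j < r" for j
    using pick_in_set[of j I] that I by auto
  \<comment> \<open>Below \<open>card I\<close> the enumeration \<open>pick I\<close> is strictly
    increasing, so different columns of \<open>E\<close> are different basis vectors.\<close>
  have pick_inj: "pick I i = pick I j \<longleftrightarrow> i = j" if "i < r" "j < r" for i j
    using pick_mono[of i I j] pick_mono[of j I i] that I by (cases i j rule: linorder_cases) auto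
  have ME: "(M * E) $$ (i, j) = M $$ (i, pick I j)"
    if "M \<in> carrier_mat l n" "i < l" "j < r" for M l i j
  proof -
    have "(M * E) $$ (i, j) = (\<Sum>k<n. if k = pick I j then M $$ (i, pick I j) else 0)"
      unfolding mult_mat_index_sum[OF that(1) E that(2,3)]
      using that(3) by (intro sum.cong) (auto simp: E_def)
    then show ?thesis using pick[OF that(3)] by simp
  qed
  have EM: "(mat_adjoint E * M) $$ (i, j) = M $$ (pick I i, j)"
    if "M \<in> carrier_mat n l" "i < r" "j < l" for M l i j
  proof -
    have "(mat_adjoint E * M) $$ (i, j) = (\<Sum>k<n. if k = pick I i then M $$ (pick I i, j) else 0)"
      unfolding mult_mat_index_sum[OF Ea that]
      using that(2) by (intro sum.cong) (auto simp: adjE)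
    then show ?thesis using pick[OF that(2)] by simp
  qed
  have "mat_adjoint E * E = 1\<^sub>m r"
    using E Ea pick pick_inj
    by (intro eq_matI) (auto simp: ME[OF Ea] adjE simp del: index_mult_mat(1))
  moreover have "submatrix A I I = mat_adjoint E * A * E"
  proof -
    \<comment> \<open>\<open>submatrix\<close> takes its dimensions from the indices of
      \<open>I\<close> that lie in range; here that is all of \<open>I\<close>, so the size is
      \<open>r\<close>.\<close>
    have "{i. i < n \<and> i \<in> I} = I" using I by auto
    then have "submatrix A I I = mat r r (\<lambda>(i, j). A $$ (pick I i, pick I j))"
      using A I by (simp add: submatrix_def)
    also have "\<dots> = mat_adjoint E * A * E"
      using E Ea A pick by (intro eq_matI)
        (auto simp: ME[OF mult_carrier_mat[OF Ea A]] EM[OF A] simp del: index_mult_mat(1))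
    finally show ?thesis .
  qed
  ultimately show thesis using that E by blast
qed

theorem theorem8:
  fixes M :: "'a measure" and n :: nat and A' :: "'a \<Rightarrow> complex mat"
  assumes "sigma_finite_measure M"
    and "n \<ge> 1"
    and "hermitian_random_matrix M n A'"
  shows "(\<forall>A. principal_random_submatrix M n (n - 1) A' A \<longrightarrow>
            (\<forall>x\<in>space M. \<forall>j\<in>{1..n - 1}.
               ordered_eigenvalue j (A' x) \<le> ordered_eigenvalue j (A x) \<and>
               ordered_eigenvalue j (A x) \<le> ordered_eigenvalue (j + 1) (A' x))) \<and>
         (\<forall>r A. 1 \<le> r \<and> r \<le> n \<and> principal_random_submatrix M n r A' A \<longrightarrow>
            (\<forall>x\<in>space M. \<forall>k\<in>{1..r}.
               ordered_eigenvalue k (A' x) \<le> ordered_eigenvalue k (A x) \<and>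
               ordered_eigenvalue k (A x) \<le> ordered_eigenvalue (k + n - r) (A' x)))"
proof -
  \<comment> \<open>One pointwise claim serves both conjuncts. It admits \<open>r = 0\<close>, which
    is the order \<open>n - 1\<close> when \<open>n = 1\<close>; the range of \<open>k\<close> is
    then empty.\<close>
  have interlace: "ordered_eigenvalue k (A' x) \<le> ordered_eigenvalue k (A x) \<and>
      ordered_eigenvalue k (A x) \<le> ordered_eigenvalue (k + n - r) (A' x)"
    if prems: "r \<le> n" "principal_random_submatrix M n r A' A" "x \<in> space M" "k \<in> {1..r}" for r A x k
  proof -
    have A': "A' x \<in> carrier_mat n n" "hermitian_mat (A' x)"
      using assms(3) prems(3) by (auto simp: hermitian_random_matrix_def random_matrix_def)
    obtain I where I: "I \<subseteq> {..<n}" "card I = r" "A x = submatrix (A' x) I I"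
      using prems(2,3) by (auto simp: principal_random_submatrix_def)
    obtain E where E: "E \<in> carrier_mat n r" "mat_adjoint E * E = 1\<^sub>m r"
      "submatrix (A' x) I I = mat_adjoint E * A' x * E"
      using submatrix_as_congruence[OF A'(1) I(1,2)] .
    show ?thesis
      using poincare_separation[OF A' E(1,2) prems(1,4)] by (simp add: I(3) E(3))
  qed
  have "\<forall>x\<in>space M. \<forall>j\<in>{1..n - 1}.
      ordered_eigenvalue j (A' x) \<le> ordered_eigenvalue j (A x) \<and>
      ordered_eigenvalue j (A x) \<le> ordered_eigenvalue (j + 1) (A' x)"
    if "principal_random_submatrix M n (n - 1) A' A" for A
  proof (intro ballI)
    fix x j assume "x \<in> space M" "j \<in> {1..n - 1}"
    \<comment> \<open>Since \<open>n \<ge> 1\<close>, the natural number \<open>n - 1\<close> is a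
      true difference and the index shift is exactly 1.\<close>
    moreover have "j + n - (n - 1) = j + 1" using assms(2) by simp
    ultimately show "ordered_eigenvalue j (A' x) \<le> ordered_eigenvalue j (A x) \<and>
        ordered_eigenvalue j (A x) \<le> ordered_eigenvalue (j + 1) (A' x)"
      using interlace[OF diff_le_self that] by simp
  qed
  with interlace show ?thesis by blast
qed

end
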